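(* Let $m\ge1$, $0=t_0<t_1<\dots<t_{m+3}$, $t_{-1}<t_0$, $t_{m+4}>t_{m+3}$, $d_k=t_k-t_{k-1}$, $\mu=\{t_0,\dots,t_{m+3}\}$, and let $\mathbf z(t)=\sum_{i=0}^{m+1}\mathbf z_iN^1_{i,\mu}(t)$, $\mathbf z_i\in\mathbb C$. Let $\nu=\{s_i\}=\{\langle t_0\rangle^2<\langle t_1\rangle^2<\dots<\langle t_{m+3}\rangle^2\}$ and $\rho=\{t_{-1}<\langle t_0\rangle^2<\dots<\langle t_{m+3}\rangle^2<t_{m+4}\}$. Then $\mathbf z^2(t)=\sum_{k=0}^{2m+4}\mathbf p_kN^2_{k,\nu}(t)$ with $\mathbf p_0=\mathbf p_{2m+4}=0$, $\mathbf p_{2k+1}=\mathbf z_k^2$ $(0\le k\le m+1)$, $\mathbf p_{2k+2}=\mathbf z_k\mathbf z_{k+1}$ $(0\le k\le m)$, and $|\mathbf z(t)|^2=\sum_{k=0}^{2m+4}\sigma_kN^2_{k,\nu}(t)$ with $\sigma_0=\sigma_{2m+4}=0$, $\sigma_{2k+1}=\mathbf z_k\bar{\mathbf z}_k$ $(0\le k\le m+1)$, $\sigma_{2k+2}=\frac12(\mathbf z_k\bar{\mathbf z}_{k+1}+\mathbf z_{k+1}\bar{\mathbf z}_k)$ $(0\le k\le m)$. Suppose that $d_{m+2}=d_1$, $d_{m+3}=d_2$ and that $\mathbf z_0,\dots,\mathbf z_{m+1}$ satisfy $\sum_{j=2-k}^{2m+3-k}(s_{j+3}-s_j)\mathbf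 p_j=0$ for $k=0,1$. Then the closed cubic Pythagorean-Hodograph B-spline curve $\mathbf r(t)$, $t\in[t_1,t_{m+2}]$, with $\mathbf r'=\mathbf z^2$ is $\mathbf r(t)=\sum_{i=0}^{2m+5}\mathbf r_iN^3_{i,\rho}(t)$ with $\mathbf r_0$ arbitrary and $$\mathbf r_1=\mathbf r_0,\quad \mathbf r_{2i+2}=\mathbf r_{2i+1}+\tfrac{d_{i+1}+d_{i+2}}3\mathbf z_i^2\ (0\le i\le m+1),\quad \mathbf r_{2i+3}=\mathbf r_{2i+2}+\tfrac{d_{i+2}}3\mathbf z_i\mathbf z_{i+1}\ (0\le i\le m),\quad \mathbf r_{2m+5}=\mathbf r_{2m+4},$$ and its total arc length is $$L=l_{2m+3}+(l_{2m+4}-l_{2m+3}-l_2)N^3_{2,\rho}(t_1),$$ where $l_1=l_0=0$, $l_{2i+2}=l_{2i+1}+\frac{d_{i+1}+d_{i+2}}3\mathbf z_i\bar{\mathbf z}_i$ $(0\le i\le m+1)$, $l_{2i+3}=l_{2i+2}+\frac{d_{i+2}}6(\mathbf z_i\bar{\mathbf z}_{i+1}+\mathbf z_{i+1}\bar{\mathbf z}_i)$ $(0\le i\le m)$, $l_{2m+5}=l_{2m+4}$.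
   Context: Normalized B-splines: for a nondecreasing knot sequence $\mu=\{t_i\}$, $N^0_{i,\mu}(t)=1$ if $t\in[t_i,t_{i+1})$ and $0$ otherwise, and $N^n_{i,\mu}(t)=\frac{t-t_i}{t_{i+n}-t_i}N^{n-1}_{i,\mu}(t)+\frac{t_{i+n+1}-t}{t_{i+n+1}-t_{i+1}}N^{n-1}_{i+1,\mu}(t)$ with $0/0=0$. Basis functions and the knots $s_i$ are indexed starting at $0$. $\langle t\rangle^k$ denotes the knot $t$ repeated $k$ times. Points of $\mathbb R^2$ are identified with complex numbers. Closed means $\mathbf r(t_1)=\mathbf r(t_{m+2})$. *)

theory Defs
  imports "HOL-Analysis.Analysis"
begin

text \<open>Normalized B-splines. A knot sequence is a function on the naturals; \<open>bspline n u i\<close> only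
  inspects \<open>u i, \<dots>, u (i + n + 1)\<close>. The convention \<open>0/0 = 0\<close> is division by zero in HOL.\<close>

fun bspline :: "nat \<Rightarrow> (nat \<Rightarrow> real) \<Rightarrow> nat \<Rightarrow> real \<Rightarrow> real" where
  "bspline 0 u i x = (if u i \<le> x \<and> x < u (i + 1) then 1 else 0)"
| "bspline (Suc n) u i x =
     (x - u i) / (u (i + Suc n) - u i) * bspline n u i x
   + (u (i + Suc n + 1) - x) / (u (i + Suc n + 1) - u (i + 1)) * bspline n u (i + 1) x"

definition spline_curve :: "nat \<Rightarrow> (nat \<Rightarrow> real) \<Rightarrow> nat \<Rightarrow> (nat \<Rightarrow> complex) \<Rightarrow> real \<Rightarrow> complex" where
  "spline_curve n u K c x = (\<Sum>i=0..K. c i * of_real (bspline n u i x))"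

text \<open>The base knots are indexed by integers, because of \<open>t\<^sub>-\<^sub>1\<close>. The closed forms of the two
  repeated knot sequences are justified by the two list lemmas below.\<close>

definition mu_knots :: "(int \<Rightarrow> real) \<Rightarrow> nat \<Rightarrow> real" where
  "mu_knots t i = t (int i)"

definition nu_knots :: "(int \<Rightarrow> real) \<Rightarrow> nat \<Rightarrow> real" where
  "nu_knots t i = t (int i div 2)"

definition rho_knots :: "(int \<Rightarrow> real) \<Rightarrow> nat \<Rightarrow> real" where
  "rho_knots t i = t ((int i - 1) div 2)"

lemma map_nu_knots:
  "map (nu_knots t) [0..<2 * n] = concat (map (\<lambda>k. replicate 2 (t (int k))) [0..<n])"
proof (induction n)
  case 0
  show ?case by simp
next
  case (Suc n)
  have "[0..<2 * Suc n] = [0..<2 * n] @ [2 * n, 2 * n + 1]"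
    by simp
  moreover have "nu_knots t (2 * n) = t (int n)" "nu_knots t (2 * n + 1) = t (int n)"
    by (simp_all add: nu_knots_def)
  ultimately show ?case
    using Suc by (simp add: numeral_2_eq_2)
qed

lemma map_rho_knots:
  "map (rho_knots t) [0..<2 * m + 10] =
     t (- 1) # concat (map (\<lambda>k. replicate 2 (t (int k))) [0..<m + 4]) @ [t (int m + 4)]"
proof -
  have split: "[0..<2 * m + 10] = 0 # map Suc [0..<2 * (m + 4)] @ [2 * m + 9]"
  proof -
    have "[0..<2 * m + 10] = [0..<Suc (2 * m + 8)] @ [2 * m + 9]"
      using upt_Suc_append[of 0 "2 * m + 9"] by (simp add: add.commute)
    also have "[0..<Suc (2 * m + 8)] = 0 # map Suc [0..<2 * m + 8]"
      by (simp only: map_Suc_upt upt_conv_Cons[OF zero_less_Suc])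
    finally show ?thesis by simp
  qed
  have "rho_knots t (Suc i) = nu_knots t i" for i
    by (simp add: rho_knots_def nu_knots_def)
  then have "map (rho_knots t) (map Suc [0..<2 * (m + 4)]) = map (nu_knots t) [0..<2 * (m + 4)]"
    by simp
  moreover have "rho_knots t 0 = t (- 1)" "rho_knots t (2 * m + 9) = t (int m + 4)"
    by (simp_all add: rho_knots_def add.commute)
  ultimately show ?thesis
    unfolding split map_nu_knots[symmetric] by simp
qed

text \<open>A planar curve with piecewise polynomial hodograph is Pythagorean if its parametric speed is, up
  to sign, a spline as well: \<open>x'\<^sup>2 + y'\<^sup>2 = \<sigma>\<^sup>2\<close>.\<close>

definition pythagorean_hodograph ::
  "nat \<Rightarrow> (nat \<Rightarrow> real) \<Rightarrow> nat \<Rightarrow> real \<Rightarrow> real \<Rightarrow> (real \<Rightarrow> complex) \<Rightarrow> bool" where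
  "pythagorean_hodograph n u K a b r \<longleftrightarrow>
     (\<exists>c :: nat \<Rightarrow> real. \<forall>x\<in>{a..b}. \<exists>v. (r has_vector_derivative v) (at x within {a..b}) \<and>
        (Re v)\<^sup>2 + (Im v)\<^sup>2 = (\<Sum>i=0..K. c i * bspline n u i x)\<^sup>2)"

definition arc_length :: "real \<Rightarrow> real \<Rightarrow> (real \<Rightarrow> complex) \<Rightarrow> real" where
  "arc_length a b r = integral {a..b} (\<lambda>x. norm (vector_derivative r (at x within {a..b})))"

definition ph_control_points ::
  "nat \<Rightarrow> (nat \<Rightarrow> real) \<Rightarrow> (nat \<Rightarrow> complex) \<Rightarrow> (nat \<Rightarrow> complex) \<Rightarrow> bool" where
  "ph_control_points m d z c \<longleftrightarrow>
     c 1 = c 0 \<and>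
     (\<forall>i\<le>m+1. c (2*i+2) = c (2*i+1) + of_real ((d (i+1) + d (i+2)) / 3) * (z i)\<^sup>2) \<and>
     (\<forall>i\<le>m. c (2*i+3) = c (2*i+2) + of_real (d (i+2) / 3) * (z i * z (i+1))) \<and>
     c (2*m+5) = c (2*m+4)"

end

theory Submission
  imports Defs
begin

text \<open>On each knot interval the linear spline is \<open>U z\<^sub>k\<^sub>-\<^sub>1 + V z\<^sub>k\<close> with \<open>U + V = 1\<close>, and the quadratic
  B-splines over the double knots are \<open>U\<^sup>2\<close>, \<open>2UV\<close>, \<open>V\<^sup>2\<close>; both product formulas are the binomial expansion.
  The cubic splines over the double knots are explicit antiderivatives on each interval, and they
  match at the knots, so adding up the integrals gives the curve and, from \<open>|r'| = |z|\<^sup>2\<close>, its arc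
  length. Closedness compares the control points next to the two end knots: the two linear conditions
  say that they agree up to an end term, and their difference that the end terms are equal.\<close>

section \<open>B-splines over general knot sequences: support and explicit values\<close>

lemma bspline_shift:
  assumes "\<And>j. v j = u (Suc j)"
  shows "bspline n v i x = bspline n u (Suc i) x"
  by (induction n arbitrary: i) (simp_all add: assms)

text \<open>In the recursion the supports of the two lower-degree splines lie inside the support of
  the higher one, so both terms vanish whatever their quotients are, even
  \<open>0/0\<close>.\<close>

lemma bspline_eq_0_outside:
  assumes "mono_on {i..i + n + 1} u" and "x < u i \<or> u (i + n + 1) \<le> x"
  shows "bspline n u i x = 0"
  using assms
proof (induction n arbitrary: i)
  case 0
  then show ?case by auto
next
  case (Suc n)
  have mono: "u j \<le> u k" if "i \<le> j" "j \<le> k" "k \<le> i + Suc n + 1" for j k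
    using that by (intro mono_onD[OF Suc.prems(1)]) auto
  have "bspline n u i x = 0"
    using Suc.prems(2) mono[of "i + n + 1" "i + Suc n + 1"]
    by (intro Suc.IH mono_onI mono) (auto intro: order_trans)
  moreover have "bspline n u (i + 1) x = 0"
    using Suc.prems(2) mono[of i "i + 1"]
    by (intro Suc.IH mono_onI mono) auto
  ultimately show ?case by simp
qed

lemma spline_curve_eq_0_outside:
  assumes "mono_on {..K + n + 1} u" and "x < u 0 \<or> u (K + n + 1) \<le> x"
  shows "spline_curve n u K c x = 0"
  unfolding spline_curve_def
proof (intro sum.neutral ballI)
  fix i assume "i \<in> {0..K}"
  then have i: "i \<le> K" by simp
  have "u 0 \<le> u i" "u (i + n + 1) \<le> u (K + n + 1)"
    using i by (auto intro!: mono_onD[OF assms(1)])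
  then have "bspline n u i x = 0"
    using assms(2) i by (intro bspline_eq_0_outside mono_on_subset[OF assms(1)]) auto
  then show "c i * of_real (bspline n u i x) = 0" by simp
qed

text \<open>Only splines whose support meets the knot interval survive. The truncated subtraction
  \<open>J - n\<close> and the \<open>min\<close> cut the range at the two ends, where fewer than
  \<open>n + 1\<close> of them exist.\<close>

lemma spline_curve_local:
  assumes "mono_on {..K + n + 1} u" and "u J \<le> x" "x < u (Suc J)" "J \<le> K + n"
  shows "spline_curve n u K c x = (\<Sum>i=J-n..min J K. c i * of_real (bspline n u i x))"
  unfolding spline_curve_def
proof (rule sum.mono_neutral_right)
  show "\<forall>i\<in>{0..K} - {J-n..min J K}. c i * of_real (bspline n u i x) = 0"
  proof
    fix i assume i: "i \<in> {0..K} - {J-n..min J K}"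
    have "x < u i \<or> u (i + n + 1) \<le> x"
    proof (cases "J < i")
      case True
      then have "u (Suc J) \<le> u i" using i by (intro mono_onD[OF assms(1)]) auto
      then show ?thesis using assms(3) by simp
    next
      case False
      then have "u (i + n + 1) \<le> u J" using i assms(4) by (intro mono_onD[OF assms(1)]) auto
      then show ?thesis using assms(2) by simp
    qed
    then have "bspline n u i x = 0"
      using i by (intro bspline_eq_0_outside mono_on_subset[OF assms(1)]) auto
    then show "c i * of_real (bspline n u i x) = 0" by simp
  qed
qed auto

lemma bspline_1_last:
  assumes "u (Suc i) \<le> x" "x < u (Suc (Suc i))"
  shows "bspline 1 u i x = (u (Suc (Suc i)) - x) / (u (Suc (Suc i)) - u (Suc i))"
  using assms by (auto simp: eval_nat_numeral)

lemma bspline_1_first: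
  assumes "u i \<le> x" "x < u (Suc i)"
  shows "bspline 1 u i x = (x - u i) / (u (Suc i) - u i)"
  using assms by (auto simp: eval_nat_numeral)

text \<open>A form without case distinction, from which continuity can be read off.\<close>

lemma bspline_1_hat:
  assumes "u i < u (Suc i)" "u (Suc i) < u (Suc (Suc i))"
  shows "bspline 1 u i x =
    max 0 (min ((x - u i) / (u (Suc i) - u i))
               ((u (Suc (Suc i)) - x) / (u (Suc (Suc i)) - u (Suc i))))"
proof -
  define A where "A = (x - u i) / (u (Suc i) - u i)"
  define B where "B = (u (Suc (Suc i)) - x) / (u (Suc (Suc i)) - u (Suc i))"
  have spline: "bspline 1 u i x =
      (if x < u i then 0 else if x < u (Suc i) then A else if x < u (Suc (Suc i)) then B else 0)"
    using assms by (auto simp: A_def B_def)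
  \<comment> \<open>Both lines take the value 1 at the middle knot; \<open>A\<close> and
    \<open>B\<close> are compared through it.\<close>
  have "x < u i \<Longrightarrow> A \<le> 0" "u i \<le> x \<Longrightarrow> 0 \<le> A" "x < u (Suc i) \<Longrightarrow> A \<le> B"
    "u (Suc i) \<le> x \<Longrightarrow> B \<le> A" "x < u (Suc (Suc i)) \<Longrightarrow> 0 \<le> B" "u (Suc (Suc i)) \<le> x \<Longrightarrow> B \<le> 0"
    using assms order_trans[of A 1 B] order_trans[of B 1 A]
    by (auto simp: A_def B_def divide_le_0_iff zero_le_divide_iff)
  then show ?thesis
    using assms unfolding spline A_def[symmetric] B_def[symmetric] by (auto simp: max_def min_def)
qed

text \<open>Between two double knots these are the quadratic Bernstein polynomials. The knots
  \<open>a\<close> and \<open>e\<close> disappear because they occur only next to splines that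
  vanish on \<open>[b, c)\<close>.\<close>

lemma bspline_2_double_knots:
  assumes u: "u i = a" "u (i+1) = b" "u (i+2) = b" "u (i+3) = c" "u (i+4) = c" "u (i+5) = e"
    and x: "a \<le> b" "b \<le> x" "x < c" "c \<le> e"
  shows "bspline 2 u i x = ((c - x) / (c - b))\<^sup>2"
    and "bspline 2 u (i+1) x = 2 * ((c - x) / (c - b)) * ((x - b) / (c - b))"
    and "bspline 2 u (i+2) x = ((x - b) / (c - b))\<^sup>2"
  using assms by (simp_all add: eval_nat_numeral)

text \<open>One more recursion step from the Bernstein polynomials. Now \<open>a\<close> and
  \<open>e\<close> stay, since over double knots a cubic spline spans two knot intervals.\<close>

lemma bspline_3_double_knots:
  assumes u: "u i = a" "u (i+1) = a" "u (i+2) = b" "u (i+3) = b" 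
      "u (i+4) = c" "u (i+5) = c" "u (i+6) = e" "u (i+7) = e"
    and x: "a \<le> b" "b \<le> x" "x < c" "c \<le> e"
  defines "U \<equiv> (c - x) / (c - b)" and "V \<equiv> (x - b) / (c - b)"
  shows "bspline 3 u i x = (c - x) / (c - a) * U\<^sup>2"
    and "bspline 3 u (i+1) x = (x - a) / (c - a) * U\<^sup>2 + 2 * U\<^sup>2 * V"
    and "bspline 3 u (i+2) x = 2 * U * V\<^sup>2 + (e - x) / (e - b) * V\<^sup>2"
    and "bspline 3 u (i+3) x = (x - b) / (e - b) * V\<^sup>2"
  using assms by (simp_all add: eval_nat_numeral mult_ac) (auto simp: algebra_simps)

text \<open>The left side is the line through \<open>c\<close> at \<open>b\<close> and
  \<open>c'\<close> at \<open>e\<close>; the recurrence between the two control points makes its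
  slope \<open>p / 3\<close>.\<close>

lemma affine_control_point:
  fixes c c' p :: complex and b e x :: real
  assumes "c' = c + of_real ((e - b) / 3) * p" and "b < e"
  shows "c * of_real ((e - x) / (e - b)) + c' * of_real ((x - b) / (e - b)) =
           c + of_real ((x - b) / 3) * p"
proof -
  define s where "s = (x - b) / (e - b)"
  have s: "(e - x) / (e - b) = 1 - s" "(x - b) / 3 = (e - b) / 3 * s"
    using assms(2) by (simp_all add: s_def field_simps)
  show ?thesis
    unfolding s(1) s(2) s_def[symmetric] assms(1) of_real_mult of_real_diff of_real_1 by algebra
qed

text \<open>Spline curves are complex-valued but arc length is a real integral. By uniqueness of the
  integral, \<open>I\<close> equals its real part.\<close>

lemma of_real_integral_eq:
  fixes f :: "'a::euclidean_space \<Rightarrow> real" and I :: complex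
  assumes "((\<lambda>x. of_real (f x)) has_integral I) A"
  shows "of_real (integral A f) = I"
proof -
  have "(f has_integral Re I) A"
    using has_integral_Re[OF assms] by simp
  then have "integral A f = Re I" "((\<lambda>x. of_real (f x)) has_integral complex_of_real (Re I)) A"
    by (rule integral_unique, rule has_integral_of_real)
  then show ?thesis
    by (metis assms has_integral_unique)
qed

section \<open>The three knot sequences built from \<open>t\<close>\<close>

locale spline_knots =
  fixes m :: nat and t :: "int \<Rightarrow> real"
  assumes knots_step: "- 1 \<le> k \<Longrightarrow> k \<le> int m + 3 \<Longrightarrow> t k < t (k + 1)"
begin

abbreviation "\<mu> \<equiv> mu_knots t"
abbreviation "\<nu> \<equiv> nu_knots t"
abbreviation "\<rho> \<equiv> rho_knots t"

lemma knots_less: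
  assumes "- 1 \<le> i" "i < j" "j \<le> int m + 4"
  shows "t i < t j"
proof -
  have "j \<le> int m + 4 \<longrightarrow> t i < t j"
    using \<open>i < j\<close>
  proof (induction j rule: int_gr_induct)
    case base
    show ?case using knots_step[of i] assms(1) by auto
  next
    case (step j)
    then show ?case using knots_step[of j] assms(1) by (auto intro: less_trans)
  qed
  then show ?thesis using assms(3) by blast
qed

lemma knots_le: "- 1 \<le> i \<Longrightarrow> i \<le> j \<Longrightarrow> j \<le> int m + 4 \<Longrightarrow> t i \<le> t j"
  using knots_less[of i j] by (cases "i = j") auto

lemma mu_knots_mono: "mono_on {..m + 3} \<mu>"
  by (auto intro!: mono_onI knots_le simp: mu_knots_def)

lemma nu_knots_mono: "mono_on {..2 * m + 7} \<nu>"
proof (rule mono_onI)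
  fix i j assume "i \<in> {..2 * m + 7}" "j \<in> {..2 * m + 7}" "i \<le> j"
  then have "0 \<le> int i" "int i \<le> int j" "int j \<le> 2 * int m + 7" by auto
  then show "\<nu> i \<le> \<nu> j"
    unfolding nu_knots_def
    using zdiv_mono1[of "int j" "2 * int m + 7" 2] zdiv_mono1[of "int i" "int j" 2]
    by (intro knots_le) simp_all
qed

lemma rho_knots_mono: "mono_on {..2 * m + 9} \<rho>"
proof (rule mono_onI)
  fix i j assume "i \<in> {..2 * m + 9}" "j \<in> {..2 * m + 9}" "i \<le> j"
  then have "0 \<le> int i" "int i \<le> int j" "int j \<le> 2 * int m + 9" by auto
  then show "\<rho> i \<le> \<rho> j"
    \<comment> \<open>Division rounds down, so index 0 gives \<open>(- 1) div 2 = - 1\<close>, the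
      additional knot.\<close>
    unfolding rho_knots_def
    using zdiv_mono1[of "int j - 1" "2 * int m + 8" 2] zdiv_mono1[of "int i - 1" "int j - 1" 2]
      zdiv_mono1[of "- 1" "int i - 1" 2]
    by (intro knots_le) simp_all
qed

lemma nu_knots_eq:
  "\<nu> (2 * k) = t (int k)" "\<nu> (Suc (2 * k)) = t (int k)"
  by (simp_all add: nu_knots_def)

lemma rho_knots_eq:
  "\<rho> (2 * k) = t (int k - 1)" "\<rho> (Suc (2 * k)) = t (int k)"
proof -
  have "(int (2 * k) - 1) div 2 = int k - 1" by presburger
  then show "\<rho> (2 * k) = t (int k - 1)" by (simp add: rho_knots_def)
qed (simp add: rho_knots_def)

lemma nu_bspline_eq_rho_bspline: "bspline n \<nu> i x = bspline n \<rho> (Suc i) x"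
  by (rule bspline_shift) (simp add: nu_knots_def rho_knots_def)

lemma knot_interval_ex:
  assumes "t 0 \<le> x" "x < t (int n)"
  shows "\<exists>k<n. t (int k) \<le> x \<and> x < t (int k + 1)"
  using assms(2)
proof (induction n)
  case 0
  then show ?case using assms(1) by simp
next
  case (Suc n)
  show ?case
  proof (cases "x < t (int n)")
    case True
    then show ?thesis using Suc.IH less_SucI by blast
  next
    case False
    then show ?thesis using Suc.prems by (auto intro!: exI[of _ n] simp: add.commute)
  qed
qed

section \<open>Linear and quadratic splines on one knot interval; the product formulas\<close>

text \<open>Barycentric coordinates of \<open>x\<close> on the interval, called \<open>U\<close> and
  \<open>V\<close> below. They are not clipped, so they stay polynomials in \<open>x\<close>, and
  they are complex so as to multiply control points directly.\<close>

definition left_weight :: "nat \<Rightarrow> real \<Rightarrow> complex" where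
  "left_weight k x = of_real ((t (int k + 1) - x) / (t (int k + 1) - t (int k)))"

definition right_weight :: "nat \<Rightarrow> real \<Rightarrow> complex" where
  "right_weight k x = of_real ((x - t (int k)) / (t (int k + 1) - t (int k)))"

abbreviation "linear_spline \<equiv> spline_curve 1 \<mu> (m + 1)"
abbreviation "quadratic_spline \<equiv> spline_curve 2 \<nu> (2 * m + 4)"
abbreviation "cubic_spline \<equiv> spline_curve 3 \<rho> (2 * m + 5)"

text \<open>The first and the last segment stand apart because only one linear spline is active
  there.\<close>

lemma segment_cases:
  assumes "k \<le> m + 2"
  obtains "k = 0" | "k = m + 2" | j where "k = Suc j" "j \<le> m"
proof -
  have "k = 0 \<or> k = m + 2 \<or> (k = Suc (k - 1) \<and> k - 1 \<le> m)"
    using assms by linarith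
  then show thesis using that by blast
qed

text \<open>The explicit case \<open>k = 0\<close> is necessary because \<open>k - 1\<close> would
  truncate to 0 and bring in \<open>z 0\<close> a second time.\<close>

lemma linear_spline_local:
  assumes k: "k \<le> m + 2" and x: "t (int k) \<le> x" "x < t (int k + 1)"
  shows "linear_spline z x = (if k = 0 then 0 else z (k - 1) * left_weight k x)
           + (if k \<le> m + 1 then z k * right_weight k x else 0)"
proof -
  have "linear_spline z x = (\<Sum>i=k-1..min k (m+1). z i * of_real (bspline 1 \<mu> i x))"
    using mu_knots_mono k x by (intro spline_curve_local)
      (auto simp: mu_knots_def add.commute eval_nat_numeral)
  moreover have "bspline 1 \<mu> k x = (x - t (int k)) / (t (int k + 1) - t (int k))"
    using bspline_1_first[of \<mu> k x] x by (simp add: mu_knots_def add.commute)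
  moreover have "bspline 1 \<mu> (k - 1) x = (t (int k + 1) - x) / (t (int k + 1) - t (int k))" if "k > 0"
    using bspline_1_last[of \<mu> "k - 1" x] that x by (simp add: mu_knots_def add.commute)
  moreover have "(\<Sum>i=k-1..min k (m+1). f i) =
      (if k = 0 then 0 else f (k - 1)) + (if k \<le> m + 1 then f k else 0)" for f :: "nat \<Rightarrow> complex"
    using segment_cases[OF k] by cases simp_all
  ultimately show ?thesis
    by (simp add: left_weight_def right_weight_def del: bspline.simps)
qed

text \<open>The \<open>\<nu>\<close>-splines are handled as \<open>\<rho>\<close>-splines: \<open>\<rho>\<close> supplies the knot \<open>t\<^sub>-\<^sub>1\<close> that makes
  the local formulas uniform in \<open>k\<close>.\<close>

lemma quadratic_spline_local:
  assumes k: "k \<le> m + 2" and x: "t (int k) \<le> x" "x < t (int k + 1)"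
  shows "quadratic_spline P x = (if k = 0 then 0 else P (2 * k - 1) * (left_weight k x)\<^sup>2)
           + 2 * P (2 * k) * left_weight k x * right_weight k x
           + (if k \<le> m + 1 then P (2 * k + 1) * (right_weight k x)\<^sup>2 else 0)"
proof -
  define U V where "U = (t (int k + 1) - x) / (t (int k + 1) - t (int k))"
    and "V = (x - t (int k)) / (t (int k + 1) - t (int k))"
  have UV: "left_weight k x = of_real U" "right_weight k x = of_real V"
    by (simp_all add: left_weight_def right_weight_def U_def V_def)
  \<comment> \<open>The nonempty knot interval starts at the second copy of the double knot, hence
    at index \<open>2 * k + 1\<close>.\<close>
  have nu: "\<nu> (2 * k + 1) = t (int k)" "\<nu> (Suc (2 * k + 1)) = t (int k + 1)"
    using nu_knots_eq(2)[of k] nu_knots_eq(1)[of "Suc k"] by (simp_all add: add.commute)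
  have "mono_on {..2 * m + 4 + 2 + 1} \<nu>"
    using nu_knots_mono by (simp add: add.commute)
  then have sum: "quadratic_spline P x =
      (\<Sum>i=2*k+1-2..min (2*k+1) (2*m+4). P i * of_real (bspline 2 \<nu> i x))"
    by (rule spline_curve_local) (use nu x k in simp_all)
  have rho: "\<rho> (2 * k) = t (int k - 1)" "\<rho> (2 * k + 1) = t (int k)" "\<rho> (2 * k + 2) = t (int k)"
    "\<rho> (2 * k + 3) = t (int k + 1)" "\<rho> (2 * k + 4) = t (int k + 1)" "\<rho> (2 * k + 5) = t (int k + 2)"
    using rho_knots_eq[of k] rho_knots_eq[of "k + 1"] rho_knots_eq[of "k + 2"]
    by (simp_all add: add.commute eval_nat_numeral)
  have "t (int k - 1) \<le> t (int k)" "t (int k + 1) \<le> t (int k + 2)"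
    using k by (auto intro!: knots_le)
  from bspline_2_double_knots[OF rho this(1) x this(2)]
  have "bspline 2 \<rho> (2 * k) x = U\<^sup>2" "bspline 2 \<rho> (2 * k + 1) x = 2 * U * V"
    "bspline 2 \<rho> (2 * k + 2) x = V\<^sup>2"
    unfolding U_def V_def .
  then have "bspline 2 \<nu> (2 * k) x = 2 * U * V"
    "bspline 2 \<nu> (2 * k + 1) x = V\<^sup>2"
    "k > 0 \<Longrightarrow> bspline 2 \<nu> (2 * k - 1) x = U\<^sup>2"
    by (simp_all add: nu_bspline_eq_rho_bspline)
  moreover have "(\<Sum>i=2*k+1-2..min (2*k+1) (2*m+4). f i) =
      (if k = 0 then 0 else f (2 * k - 1)) + f (2 * k) + (if k \<le> m + 1 then f (2 * k + 1) else 0)"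
    for f :: "nat \<Rightarrow> complex"
    using segment_cases[OF k]
  proof cases
    case (3 j)
    then have "{2*k+1-2..min (2*k+1) (2*m+4)} = {2*j+1, 2*j+2, 2*j+3}" by auto
    then show ?thesis using 3 by (simp add: eval_nat_numeral)
  qed (simp_all add: eval_nat_numeral)
  ultimately show ?thesis
    unfolding sum by (simp add: UV)
qed

text \<open>Stated for a pair so that \<open>w = z\<close> gives the square and the conjugate of
  \<open>z\<close> gives the squared modulus. The factor \<open>1 / 2\<close> compensates for the 2
  in \<open>2UV\<close>.\<close>

lemma quadratic_spline_eq_product:
  assumes ends: "P 0 = 0" "P (2 * m + 4) = 0"
    and odd: "\<And>k. k \<le> m + 1 \<Longrightarrow> P (2 * k + 1) = z k * w k"
    and even: "\<And>k. k \<le> m \<Longrightarrow> P (2 * k + 2) = 1 / 2 * (z k * w (k + 1) + z (k + 1) * w k)"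
  shows "linear_spline z x * linear_spline w x = quadratic_spline P x"
proof (cases "t 0 \<le> x \<and> x < t (int (m + 3))")
  case False
  have "linear_spline z x = 0"
    using mu_knots_mono False by (intro spline_curve_eq_0_outside) (auto simp: mu_knots_def add_ac eval_nat_numeral)
  moreover have "quadratic_spline P x = 0"
    using nu_knots_mono nu_knots_eq(2)[of "m + 3"] False
    by (intro spline_curve_eq_0_outside) (auto simp: nu_knots_def add_ac eval_nat_numeral)
  ultimately show ?thesis by simp
next
  case True
  then obtain k where "k < m + 3" and x: "t (int k) \<le> x" "x < t (int k + 1)"
    using knot_interval_ex[of x "m + 3"] by blast
  then have k: "k \<le> m + 2" by simp
  note loc = linear_spline_local[OF k x] quadratic_spline_local[OF k x]
  consider "k = 0" | "k = m + 2" | j where "k = Suc j" "j \<le> m"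
    using segment_cases[OF k] .
  then show ?thesis
  proof cases
    \<comment> \<open>Here the product is just \<open>z 0 * w 0\<close> times
      \<open>V\<^sup>2\<close>, and \<open>P 0 = 0\<close> removes the mixed term; the last segment
      is symmetric.\<close>
    case 1
    then show ?thesis using odd[of 0] ends unfolding loc by (simp add: power2_eq_square)
  next
    case 2
    then show ?thesis using odd[of "m + 1"] ends unfolding loc
      by (simp add: power2_eq_square eval_nat_numeral)
  next
    case 3
    then show ?thesis using odd[of j] odd[of "j + 1"] even[of j] unfolding loc
      by (simp add: power2_eq_square eval_nat_numeral field_simps)
  qed
qed

text \<open>Includes the right end, although B-splines live on half-open intervals: there the value
  comes from the next segment, and both formulas give \<open>P (2 * j + 3)\<close>.\<close>

lemma quadratic_spline_segment:
  assumes "j \<le> m" and "x \<in> {t (int j + 1)..t (int j + 2)}"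
  shows "quadratic_spline P x = P (2 * j + 1) * (left_weight (j + 1) x)\<^sup>2
           + 2 * P (2 * j + 2) * left_weight (j + 1) x * right_weight (j + 1) x
           + P (2 * j + 3) * (right_weight (j + 1) x)\<^sup>2"
proof (cases "x < t (int j + 2)")
  case True
  then show ?thesis
    using quadratic_spline_local[of "j + 1" x P] assms by (simp add: add_ac eval_nat_numeral)
next
  case False
  then have x: "x = t (int j + 2)" using assms by simp
  have less: "t (int j + 2) < t (int j + 3)" "t (int j + 1) < t (int j + 2)"
    using assms by (auto intro: knots_less)
  then have "left_weight (j + 1) x = 0" "right_weight (j + 1) x = 1"
    "left_weight (j + 2) x = 1" "right_weight (j + 2) x = 0"
    by (simp_all add: left_weight_def right_weight_def x add_ac)
  then show ?thesis
    using quadratic_spline_local[of "j + 2" x P] assms less x by (simp add: add_ac eval_nat_numeral)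
qed

text \<open>Through the product formula this makes the hodograph continuous.\<close>

lemma continuous_on_linear_spline: "continuous_on A (linear_spline z)"
proof -
  have "continuous_on A (bspline 1 \<mu> i)" if "i \<le> m + 1" for i
  proof -
    have "\<mu> i < \<mu> (Suc i)" "\<mu> (Suc i) < \<mu> (Suc (Suc i))"
      using that by (auto simp: mu_knots_def intro!: knots_less)
    then have "bspline 1 \<mu> i = (\<lambda>x. max 0 (min ((x - \<mu> i) / (\<mu> (Suc i) - \<mu> i))
        ((\<mu> (Suc (Suc i)) - x) / (\<mu> (Suc (Suc i)) - \<mu> (Suc i)))))"
      by (intro ext bspline_1_hat)
    then show ?thesis
      using \<open>\<mu> i < \<mu> (Suc i)\<close> \<open>\<mu> (Suc i) < \<mu> (Suc (Suc i))\<close>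
      by (simp only:) (intro continuous_intros; simp)
  qed
  then show ?thesis
    unfolding spline_curve_def[abs_def]
    by (intro continuous_on_sum continuous_on_mult continuous_on_const continuous_on_of_real) simp
qed

lemma weights_add:
  assumes "k \<le> m + 3"
  shows "left_weight k x + right_weight k x = 1"
proof -
  have "t (int k) < t (int k + 1)"
    using assms by (auto intro: knots_less)
  then show ?thesis
    unfolding left_weight_def right_weight_def of_real_add[symmetric] of_real_eq_1_iff
    by (simp add: add_divide_distrib[symmetric])
qed

section \<open>Cubic splines on one knot interval and the recurrence of their control points\<close>

text \<open>The active splines are \<open>2 * j + 1\<close> to \<open>2 * j + 4\<close>; for
  \<open>j = m + 1\<close> the last index exceeds \<open>2 * m + 5\<close>. That interval serves
  only for the value at its left end, the final parameter.\<close>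

lemma cubic_spline_local:
  assumes j: "j \<le> m + 1" and x: "t (int j + 1) \<le> x" "x < t (int j + 2)"
  defines "U \<equiv> left_weight (j + 1) x" and "V \<equiv> right_weight (j + 1) x"
  shows "cubic_spline c x =
      c (2 * j + 1) * (of_real ((t (int j + 2) - x) / (t (int j + 2) - t (int j))) * U\<^sup>2)
    + c (2 * j + 2) * (of_real ((x - t (int j)) / (t (int j + 2) - t (int j))) * U\<^sup>2 + 2 * U\<^sup>2 * V)
    + c (2 * j + 3) * (2 * U * V\<^sup>2 + of_real ((t (int j + 3) - x) / (t (int j + 3) - t (int j + 1))) * V\<^sup>2)
    + (if j \<le> m then
         c (2 * j + 4) * (of_real ((x - t (int j + 1)) / (t (int j + 3) - t (int j + 1))) * V\<^sup>2)
       else 0)"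
proof -
  have rho: "\<rho> (2 * j + 1) = t (int j)" "\<rho> (2 * j + 1 + 1) = t (int j)"
    "\<rho> (2 * j + 1 + 2) = t (int j + 1)" "\<rho> (2 * j + 1 + 3) = t (int j + 1)"
    "\<rho> (2 * j + 1 + 4) = t (int j + 2)" "\<rho> (2 * j + 1 + 5) = t (int j + 2)"
    "\<rho> (2 * j + 1 + 6) = t (int j + 3)" "\<rho> (2 * j + 1 + 7) = t (int j + 3)"
    using rho_knots_eq[of j] rho_knots_eq[of "j + 1"] rho_knots_eq[of "j + 2"]
      rho_knots_eq[of "j + 3"] rho_knots_eq[of "j + 4"]
    by (simp_all add: add.commute eval_nat_numeral)
  have "mono_on {..2 * m + 5 + 3 + 1} \<rho>"
    using rho_knots_mono by (simp add: add.commute)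
  then have sum: "cubic_spline c x =
      (\<Sum>i=2*j+4-3..min (2*j+4) (2*m+5). c i * of_real (bspline 3 \<rho> i x))"
    by (rule spline_curve_local) (use rho(4,5) x j in \<open>simp_all add: eval_nat_numeral\<close>)
  have range: "(\<Sum>i=2*j+4-3..min (2*j+4) (2*m+5). f i) = f (2 * j + 1) + f (2 * j + 1 + 1)
      + f (2 * j + 1 + 2) + (if j \<le> m then f (2 * j + 1 + 3) else 0)" for f :: "nat \<Rightarrow> complex"
  proof (cases "j \<le> m")
    case True
    then have "{2*j+4-3..min (2*j+4) (2*m+5)} = {2*j+1, 2*j+2, 2*j+3, 2*j+4}" by auto
    then show ?thesis using True by (simp add: eval_nat_numeral)
  next
    case False
    then have "{2*j+4-3..min (2*j+4) (2*m+5)} = {2*j+1, 2*j+2, 2*j+3}" using j by auto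
    then show ?thesis using False by (simp add: eval_nat_numeral)
  qed
  have "t (int j) \<le> t (int j + 1)" "t (int j + 2) \<le> t (int j + 3)"
    using j by (auto intro!: knots_le)
  note splines = bspline_3_double_knots[OF rho this(1) x this(2)]
  have UV: "U = of_real ((t (int j + 2) - x) / (t (int j + 2) - t (int j + 1)))"
    "V = of_real ((x - t (int j + 1)) / (t (int j + 2) - t (int j + 1)))"
    by (simp_all add: U_def V_def left_weight_def right_weight_def add_ac)
  have idx: "2 * j + 1 + 1 = 2 * j + 2" "2 * j + 1 + 2 = 2 * j + 3" "2 * j + 1 + 3 = 2 * j + 4"
    by simp_all
  show ?thesis
    unfolding sum range splines UV
    by (simp only: idx of_real_add of_real_mult of_real_power of_real_numeral)
qed

lemma cubic_spline_knot:
  assumes "j \<le> m + 1"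
  shows "cubic_spline c (t (int j + 1)) =
      c (2 * j + 1) * of_real ((t (int j + 2) - t (int j + 1)) / (t (int j + 2) - t (int j)))
    + c (2 * j + 2) * of_real ((t (int j + 1) - t (int j)) / (t (int j + 2) - t (int j)))"
proof -
  have less: "t (int j + 1) < t (int j + 2)"
    using assms by (auto intro: knots_less)
  then have "left_weight (j + 1) (t (int j + 1)) = 1" "right_weight (j + 1) (t (int j + 1)) = 0"
    by (simp_all add: left_weight_def right_weight_def add_ac)
  then show ?thesis
    using cubic_spline_local[OF assms order_refl less, of c] by simp
qed

text \<open>Kept general in \<open>P\<close>: the control points of the curve arise for \<open>P = p\<close>, those of its arc
  length for \<open>P = \<sigma>\<close>.\<close>

definition integral_coeffs :: "(nat \<Rightarrow> complex) \<Rightarrow> (nat \<Rightarrow> complex) \<Rightarrow> bool" where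
  "integral_coeffs P c \<longleftrightarrow>
     (\<forall>i\<le>2 * m + 4. c (Suc i) = c i + of_real ((\<nu> (i + 3) - \<nu> i) / 3) * P i)"

text \<open>Because knots are double, quadratic spline \<open>2 * j + 1\<close> is supported on two
  knot intervals and spline \<open>2 * j + 2\<close> on one. Hence the two kinds of weight in the
  recurrence.\<close>

lemma integral_coeffs_odd:
  assumes "integral_coeffs P c" "j \<le> m + 1"
  shows "c (2 * j + 2) = c (2 * j + 1) + of_real ((t (int j + 2) - t (int j)) / 3) * P (2 * j + 1)"
proof -
  have "\<nu> (2 * j + 1 + 3) = t (int j + 2)"
    using nu_knots_eq(1)[of "j + 2"] by (simp add: add.commute eval_nat_numeral)
  then show ?thesis
    using assms nu_knots_eq(2)[of j] unfolding integral_coeffs_def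
    by (auto dest!: spec[of _ "2 * j + 1"])
qed

lemma integral_coeffs_even:
  assumes "integral_coeffs P c" "j \<le> m + 1"
  shows "c (2 * j + 3) = c (2 * j + 2) + of_real ((t (int j + 2) - t (int j + 1)) / 3) * P (2 * j + 2)"
proof -
  have "\<nu> (2 * j + 2 + 3) = t (int j + 2)" "\<nu> (2 * j + 2) = t (int j + 1)"
    using nu_knots_eq(2)[of "j + 2"] nu_knots_eq(1)[of "j + 1"]
    by (simp_all add: add.commute eval_nat_numeral)
  then show ?thesis
    using assms unfolding integral_coeffs_def
    by (auto dest!: spec[of _ "2 * j + 2"] simp: eval_nat_numeral)
qed

text \<open>The value at a knot computed from the segment to its right; it also closes the segment
  to its left.\<close>

lemma cubic_spline_knot_integral_coeffs:
  assumes "integral_coeffs P c" "j \<le> m + 1"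
  shows "cubic_spline c (t (int j + 1)) =
      c (2 * j + 1) + of_real ((t (int j + 1) - t (int j)) / 3) * P (2 * j + 1)"
proof -
  have "t (int j) < t (int j + 2)"
    using assms by (auto intro: knots_less)
  then show ?thesis
    unfolding cubic_spline_knot[OF assms(2)]
    by (intro affine_control_point integral_coeffs_odd assms)
qed

text \<open>In this form, with the derivatives of the two weights being opposite constants, the derivative
  is visibly the expression in \<open>quadratic_spline_segment\<close>.\<close>

lemma cubic_spline_segment:
  assumes c: "integral_coeffs P c" and j: "j \<le> m"
    and x: "x \<in> {t (int j + 1)..t (int j + 2)}"
  defines "h \<equiv> of_real ((t (int j + 2) - t (int j + 1)) / 3)"
    and "U \<equiv> left_weight (j + 1) x" and "V \<equiv> right_weight (j + 1) x"
  shows "cubic_spline c x = c (2 * j + 2) - h * P (2 * j + 1) * U ^ 3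
           + h * P (2 * j + 2) * (3 * V\<^sup>2 - 2 * V ^ 3) + h * P (2 * j + 3) * V ^ 3"
proof (cases "x < t (int j + 2)")
  case True
  have less: "t (int j) < t (int j + 2)" "t (int j + 1) < t (int j + 3)" "t (int j + 1) < t (int j + 2)"
    using j by (auto intro: knots_less)
  note c1 = integral_coeffs_odd[OF c, of j] and c2 = integral_coeffs_even[OF c, of j]
    and c3 = integral_coeffs_odd[OF c, of "j + 1"]
  \<comment> \<open>\<open>C1\<close> and \<open>C2\<close> collect the terms with the outer
    quotients; they carry the factors \<open>U\<^sup>2\<close> and \<open>V\<^sup>2\<close>, and
    each is affine in \<open>x\<close>.\<close>
  define C1 where "C1 = c (2 * j + 1) * of_real ((t (int j + 2) - x) / (t (int j + 2) - t (int j))) +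
      c (2 * j + 2) * of_real ((x - t (int j)) / (t (int j + 2) - t (int j)))"
  define C2 where "C2 = c (2 * j + 3) * of_real ((t (int j + 3) - x) / (t (int j + 3) - t (int j + 1))) +
      c (2 * j + 4) * of_real ((x - t (int j + 1)) / (t (int j + 3) - t (int j + 1)))"
  have "C1 = c (2 * j + 1) + of_real ((x - t (int j)) / 3) * P (2 * j + 1)"
    unfolding C1_def using c1 j less by (intro affine_control_point) simp_all
  also have "\<dots> = c (2 * j + 2) - of_real ((t (int j + 2) - x) / 3) * P (2 * j + 1)"
    using c1 j by (simp add: diff_divide_distrib algebra_simps)
  also have "of_real ((t (int j + 2) - x) / 3) = h * U"
    unfolding h_def U_def left_weight_def of_real_mult[symmetric]
    using less(3) by (intro arg_cong[of _ _ of_real]) (simp add: field_simps)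
  finally have C1: "C1 = c (2 * j + 2) - h * U * P (2 * j + 1)" .
  have "C2 = c (2 * j + 3) + of_real ((x - t (int j + 1)) / 3) * P (2 * j + 3)"
    unfolding C2_def using c3 j less
    by (intro affine_control_point) (simp_all add: add_ac eval_nat_numeral)
  also have "of_real ((x - t (int j + 1)) / 3) = h * V"
    unfolding h_def V_def right_weight_def of_real_mult[symmetric]
    using less(3) by (intro arg_cong[of _ _ of_real]) (simp add: field_simps)
  finally have C2: "C2 = c (2 * j + 2) + h * P (2 * j + 2) + h * V * P (2 * j + 3)"
    using c2 j by (simp add: h_def)
  have U: "U = 1 - V"
    using weights_add[of "j + 1" x] j by (simp add: U_def V_def eq_diff_eq)
  have "cubic_spline c x = U\<^sup>2 * C1 + 2 * U\<^sup>2 * V * c (2 * j + 2)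
      + 2 * U * V\<^sup>2 * c (2 * j + 3) + V\<^sup>2 * C2"
    using cubic_spline_local[of j x c] x True j
    by (simp add: C1_def C2_def U_def V_def algebra_simps)
  also have "c (2 * j + 3) = c (2 * j + 2) + h * P (2 * j + 2)"
    using c2 j by (simp add: h_def)
  finally show ?thesis
    unfolding C1 C2 U by algebra
next
  case False
  \<comment> \<open>The right end belongs to the next half-open segment, so its value is taken from
    there.\<close>
  then have x': "x = t (int (j + 1) + 1)" using x by (simp add: add_ac)
  have "t (int j + 1) < t (int j + 2)"
    using j by (auto intro: knots_less)
  then have "U = 0" "V = 1"
    unfolding U_def V_def by (simp_all add: left_weight_def right_weight_def x' add_ac)
  moreover have "cubic_spline c x = c (2 * j + 3) + h * P (2 * j + 3)"
    using cubic_spline_knot_integral_coeffs[OF c, of "j + 1"] j unfolding x'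
    by (simp add: h_def add_ac eval_nat_numeral)
  ultimately show ?thesis
    using integral_coeffs_even[OF c, of j] j by (simp add: h_def)
qed

section \<open>Integrals of quadratic splines and derivatives of cubic splines\<close>

lemma quadratic_spline_has_integral_segment:
  assumes c: "integral_coeffs P c" and j: "j \<le> m"
    and x: "x \<in> {t (int j + 1)..t (int j + 2)}"
  shows "(quadratic_spline P has_integral cubic_spline c x - cubic_spline c (t (int j + 1)))
           {t (int j + 1)..x}"
proof (rule fundamental_theorem_of_calculus)
  show "t (int j + 1) \<le> x" using x by simp
  fix y assume y: "y \<in> {t (int j + 1)..x}"
  define H B E where "H = complex_of_real (t (int j + 2) - t (int j + 1))"
    and "B = complex_of_real (t (int j + 1))" and "E = complex_of_real (t (int j + 2))"
  have "t (int j + 1) < t (int j + 2)"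
    using j by (auto intro: knots_less)
  then have "H \<noteq> 0" by (simp add: H_def)
  \<comment> \<open>The segment formula as a polynomial in a complex variable, so that it can be
    differentiated in the field and then restricted to the reals.\<close>
  define F where "F w = c (2 * j + 2) - H / 3 * P (2 * j + 1) * ((E - w) / H) ^ 3
      + H / 3 * P (2 * j + 2) * (3 * ((w - B) / H)\<^sup>2 - 2 * ((w - B) / H) ^ 3)
      + H / 3 * P (2 * j + 3) * ((w - B) / H) ^ 3" for w
  have weights: "left_weight (j + 1) w = (E - of_real w) / H"
    "right_weight (j + 1) w = (of_real w - B) / H" for w
    by (simp_all add: left_weight_def right_weight_def H_def E_def B_def add_ac)
  have F: "cubic_spline c w = F (of_real w)" if "w \<in> {t (int j + 1)..x}" for w
    using cubic_spline_segment[OF c j, of w] that x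
    unfolding F_def weights by (simp add: H_def)
  have "(F has_field_derivative P (2 * j + 1) * ((E - of_real y) / H)\<^sup>2
      + 2 * P (2 * j + 2) * ((E - of_real y) / H) * ((of_real y - B) / H)
      + P (2 * j + 3) * ((of_real y - B) / H)\<^sup>2) (at (of_real y))"
  proof -
    \<comment> \<open>This encodes \<open>U = 1 - V\<close>, which turns the derivative of
      \<open>3V\<^sup>2 - 2V\<^sup>3\<close> into the mixed term.\<close>
    have "E = H + B" by (simp add: H_def E_def B_def)
    then show ?thesis
      unfolding F_def using \<open>H \<noteq> 0\<close>
      by (auto intro!: derivative_eq_intros simp: field_simps power2_eq_square power3_eq_cube)
  qed
  moreover have "quadratic_spline P y = P (2 * j + 1) * ((E - of_real y) / H)\<^sup>2
      + 2 * P (2 * j + 2) * ((E - of_real y) / H) * ((of_real y - B) / H)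
      + P (2 * j + 3) * ((of_real y - B) / H)\<^sup>2"
    using quadratic_spline_segment[OF j, of y P] x y unfolding weights by simp
  ultimately have "((\<lambda>w. F (of_real w)) has_vector_derivative quadratic_spline P y)
      (at y within {t (int j + 1)..x})"
    by (intro has_vector_derivative_real_field) simp
  then show "(cubic_spline c has_vector_derivative quadratic_spline P y)
      (at y within {t (int j + 1)..x})"
    using F by (rule has_vector_derivative_transform[OF y, rotated])
qed

lemma quadratic_spline_has_integral:
  assumes c: "integral_coeffs P c" and x: "x \<in> {t 1..t (int m + 2)}"
  shows "(quadratic_spline P has_integral cubic_spline c x - cubic_spline c (t 1)) {t 1..x}"
proof -
  \<comment> \<open>Induction on the number of segments, for all \<open>x\<close>: the hypothesis is
    applied at the last knot before \<open>x\<close>, and the increments telescope.\<close>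
  have "n \<le> m + 1 \<Longrightarrow> x \<in> {t 1..t (int n + 1)} \<Longrightarrow>
      (quadratic_spline P has_integral cubic_spline c x - cubic_spline c (t 1)) {t 1..x}" for n x
  proof (induction n arbitrary: x)
    case 0
    then show ?case by (auto simp: has_integral_refl)
  next
    case (Suc n)
    show ?case
    proof (cases "x \<le> t (int n + 1)")
      case True
      then show ?thesis using Suc by auto
    next
      case False
      have le: "t 1 \<le> t (int n + 1)"
        using Suc.prems(1) by (intro knots_le) auto
      have "(quadratic_spline P has_integral cubic_spline c (t (int n + 1)) - cubic_spline c (t 1))
          {t 1..t (int n + 1)}"
        using Suc le by simp
      moreover have "(quadratic_spline P has_integral cubic_spline c x - cubic_spline c (t (int n + 1)))
          {t (int n + 1)..x}"
        using Suc.prems False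
        by (intro quadratic_spline_has_integral_segment[OF c]) (auto simp: add_ac)
      ultimately show ?thesis
        using has_integral_combine[OF le, of x "quadratic_spline P"] False by fastforce
    qed
  qed
  from this[of "m + 1" x] show ?thesis using x by (simp add: add_ac)
qed

text \<open>Up to a constant the cubic spline is the indefinite integral of a continuous function,
  so no one-sided derivatives have to be matched at the knots.\<close>

lemma cubic_spline_has_vector_derivative:
  assumes c: "integral_coeffs P c" and x: "x \<in> {t 1..t (int m + 2)}"
    and cont: "continuous_on {t 1..t (int m + 2)} (quadratic_spline P)"
  shows "(cubic_spline c has_vector_derivative quadratic_spline P x) (at x within {t 1..t (int m + 2)})"
proof -
  have "((\<lambda>y. cubic_spline c (t 1) + integral {t 1..y} (quadratic_spline P))
      has_vector_derivative 0 + quadratic_spline P x) (at x within {t 1..t (int m + 2)})"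
    by (intro has_vector_derivative_add has_vector_derivative_const
        integral_has_vector_derivative[OF cont x])
  then have "((\<lambda>y. cubic_spline c (t 1) + integral {t 1..y} (quadratic_spline P))
      has_vector_derivative quadratic_spline P x) (at x within {t 1..t (int m + 2)})"
    by simp
  then show ?thesis
    by (rule has_vector_derivative_transform[OF x, rotated])
      (simp add: integral_unique[OF quadratic_spline_has_integral[OF c]])
qed

section \<open>Control points, closedness and the length formula\<close>

lemma integral_coeffs_sum:
  assumes "integral_coeffs P c" "n \<le> 2 * m + 4"
  shows "c (Suc n) = c 1 + (\<Sum>i=1..n. of_real (\<nu> (i + 3) - \<nu> i) * P i) / 3"
  using assms(2)
proof (induction n)
  case (Suc n)
  then show ?case using assms(1) unfolding integral_coeffs_def
    by (simp add: add_divide_distrib)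
qed simp

text \<open>The uniform recurrence splits by the parity of the index; its first and last steps are
  trivial because \<open>P\<close> vanishes there.\<close>

lemma integral_coeffs_iff:
  assumes d: "\<forall>k\<in>{1..m+3}. d k = t (int k) - t (int k - 1)"
    and P_ends: "P 0 = 0" "P (2 * m + 4) = 0"
  shows "integral_coeffs P c \<longleftrightarrow> c 1 = c 0 \<and>
     (\<forall>i\<le>m+1. c (2*i+2) = c (2*i+1) + of_real ((d (i+1) + d (i+2)) / 3) * P (2*i+1)) \<and>
     (\<forall>i\<le>m. c (2*i+3) = c (2*i+2) + of_real (d (i+2) / 3) * P (2*i+2)) \<and>
     c (2*m+5) = c (2*m+4)" (is "_ \<longleftrightarrow> ?R")
proof -
  have odd: "t (int i + 2) - t (int i) = d (i + 1) + d (i + 2)" if "i \<le> m + 1" for i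
    using that bspec[OF d, of "i + 1"] bspec[OF d, of "i + 2"] by (simp add: add_ac)
  have even: "t (int i + 2) - t (int i + 1) = d (i + 2)" if "i \<le> m" for i
    using that bspec[OF d, of "i + 2"] by (simp add: add_ac)
  show ?thesis
  proof
    assume c: "integral_coeffs P c"
    show ?R
    proof (intro conjI allI impI)
      show "c 1 = c 0" "c (2 * m + 5) = c (2 * m + 4)"
        using c P_ends by (auto simp: integral_coeffs_def dest: spec[of _ 0] spec[of _ "2 * m + 4"]
            simp: eval_nat_numeral)
      show "c (2 * i + 2) = c (2 * i + 1) + of_real ((d (i + 1) + d (i + 2)) / 3) * P (2 * i + 1)"
        if "i \<le> m + 1" for i
        using integral_coeffs_odd[OF c that] odd[OF that] by simp
      show "c (2 * i + 3) = c (2 * i + 2) + of_real (d (i + 2) / 3) * P (2 * i + 2)"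
        if "i \<le> m" for i
        using integral_coeffs_even[OF c, of i] even[OF that] that by simp
    qed
  next
    assume c: ?R
    show "integral_coeffs P c"
      unfolding integral_coeffs_def
    proof (intro allI impI)
      fix n assume "n \<le> 2 * m + 4"
      then have "n = 0 \<or> n = 2 * m + 4 \<or> (\<exists>i\<le>m+1. n = 2 * i + 1) \<or> (\<exists>i\<le>m. n = 2 * i + 2)"
        by presburger
      then consider "n = 0" | "n = 2 * m + 4" | i where "i \<le> m + 1" "n = 2 * i + 1"
        | i where "i \<le> m" "n = 2 * i + 2"
        by blast
      then show "c (Suc n) = c n + of_real ((\<nu> (n + 3) - \<nu> n) / 3) * P n"
      proof cases
        case 1
        then show ?thesis using c P_ends by simp
      next
        case 2
        then show ?thesis using c P_ends by (simp add: eval_nat_numeral)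
      next
        case (3 i)
        have "\<nu> (n + 3) - \<nu> n = d (i + 1) + d (i + 2)"
          using nu_knots_eq(1)[of "i + 2"] nu_knots_eq(2)[of i] odd[OF 3(1)] 3
          by (simp add: add_ac eval_nat_numeral)
        then show ?thesis using c 3 by simp
      next
        case (4 i)
        have "\<nu> (n + 3) - \<nu> n = d (i + 2)"
          using nu_knots_eq(2)[of "i + 2"] nu_knots_eq(1)[of "i + 1"] even[OF 4(1)] 4
          by (simp add: add_ac eval_nat_numeral)
        then show ?thesis using c 4 by (simp add: eval_nat_numeral)
      qed
    qed
  qed
qed

lemma integral_coeffs_ex: "\<exists>c. c 0 = c0 \<and> integral_coeffs P c"
  by (rule exI[of _ "rec_nat c0 (\<lambda>i y. y + of_real ((\<nu> (i + 3) - \<nu> i) / 3) * P i)"])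
    (simp add: integral_coeffs_def)

lemma cubic_spline_increment:
  assumes c: "integral_coeffs P c"
  shows "cubic_spline c (t (int m + 2)) - cubic_spline c (t 1) =
      (c (2 * m + 3) + of_real ((t (int m + 2) - t (int m + 1)) / 3) * P (2 * m + 3))
    - (c 1 + of_real ((t 1 - t 0) / 3) * P 1)"
  using cubic_spline_knot_integral_coeffs[OF c, of "m + 1"] cubic_spline_knot_integral_coeffs[OF c, of 0]
  by (simp add: add_ac eval_nat_numeral)

lemma cubic_spline_closed:
  assumes c: "integral_coeffs P c"
    and per: "t (int m + 2) - t (int m + 1) = t 1 - t 0" "t (int m + 3) - t (int m + 2) = t 2 - t 1"
    and closed: "\<And>k. k \<in> {0, 1} \<Longrightarrow>
      (\<Sum>j=2-k..2*m+3-k. of_real (\<nu> (j + 3) - \<nu> j) * P j) = 0"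
  shows "cubic_spline c (t (int m + 2)) = cubic_spline c (t 1)"
proof -
  define f where "f j = of_real (\<nu> (j + 3) - \<nu> j) * P j" for j
  have sum1: "sum f {1..2 * m + 2} = 0"
    using closed[of 1] by (simp add: f_def eval_nat_numeral)
  have "f 1 + sum f {2..2 * m + 3} = sum f {1..2 * m + 3}"
    using sum.atLeast_Suc_atMost[of 1 "2 * m + 3" f] by (simp add: eval_nat_numeral)
  also have "\<dots> = sum f {1..2 * m + 2} + f (2 * m + 3)"
    using sum.nat_ivl_Suc'[of 1 "2 * m + 2" f] by (simp add: eval_nat_numeral)
  \<comment> \<open>Subtracting the two conditions leaves the end terms; equal weights then give \<open>z\<^sub>0\<^sup>2 = z\<^sub>m\<^sub>+\<^sub>1\<^sup>2\<close>.\<close>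
  finally have "f 1 = f (2 * m + 3)"
    using closed[of 0] sum1 by (simp add: f_def)
  moreover have "\<nu> 1 = t 0" "\<nu> (1 + 3) = t 2" "\<nu> (2 * m + 3) = t (int m + 1)"
    "\<nu> (2 * m + 3 + 3) = t (int m + 3)"
    using nu_knots_eq(2)[of 0] nu_knots_eq(1)[of 2] nu_knots_eq(2)[of "m + 1"] nu_knots_eq(1)[of "m + 3"]
    by (simp_all add: add_ac eval_nat_numeral)
  moreover have "t (int m + 3) - t (int m + 1) = t 2 - t 0" using per by simp
  moreover have "t 0 < t 2" by (rule knots_less) auto
  ultimately have "P 1 = P (2 * m + 3)"
    by (simp add: f_def del: of_real_diff)
  \<comment> \<open>The closing condition for \<open>k = 1\<close> is this equality after
    telescoping.\<close>
  moreover have "c (2 * m + 3) = c 1"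
    using integral_coeffs_sum[OF c, of "2 * m + 2"] sum1
    by (simp add: f_def eval_nat_numeral)
  ultimately show ?thesis
    using cubic_spline_increment[OF c] per(1) by simp
qed

text \<open>The left end of the interval, where \<open>U = 1\<close> and
  \<open>V = 0\<close>.\<close>

lemma bspline_3_at_first_knot:
  "bspline 3 \<rho> 2 (t 1) = (t 1 - t 0) / (t 2 - t 0)"
proof -
  have "t 0 \<le> t 1" "t 1 < t 2" "t 2 \<le> t 3"
    by (auto intro!: knots_le knots_less)
  then show ?thesis
    using bspline_3_double_knots(2)[of \<rho> 1 "t 0" "t 1" "t 2" "t 3" "t 1"]
    by (simp add: rho_knots_def eval_nat_numeral)
qed

text \<open>Equal spacing at both ends makes the weight \<open>s\<close> the same there: the end
  value is \<open>(1 - s) l (2 * m + 3) + s l (2 * m + 4)\<close>, the start value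
  \<open>s l 2\<close>.\<close>

lemma cubic_spline_increment_from_0:
  assumes l: "integral_coeffs S l" "l 0 = 0" "l 1 = 0"
    and per: "t (int m + 2) - t (int m + 1) = t 1 - t 0" "t (int m + 3) - t (int m + 2) = t 2 - t 1"
  shows "cubic_spline l (t (int m + 2)) - cubic_spline l (t 1) =
    l (2 * m + 3) + (l (2 * m + 4) - l (2 * m + 3) - l 2) * of_real (bspline 3 \<rho> 2 (t 1))"
proof -
  define s where "s = (t 1 - t 0) / (t 2 - t 0)"
  have "t 0 < t 2" by (rule knots_less) auto
  then have s': "(t 2 - t 1) / (t 2 - t 0) = 1 - s"
    by (simp add: s_def field_simps)
  have "t (int m + 3) - t (int m + 1) = t 2 - t 0" using per by simp
  then have "cubic_spline l (t (int m + 2)) = l (2 * m + 3) * of_real (1 - s) + l (2 * m + 4) * of_real s"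
    using cubic_spline_knot[of "m + 1" l] per s'
    by (simp add: s_def add_ac eval_nat_numeral del: of_real_diff of_real_divide)
  moreover have "cubic_spline l (t 1) = l 2 * of_real s"
    using cubic_spline_knot[of 0 l] l(3) by (simp add: s_def eval_nat_numeral)
  ultimately show ?thesis
    unfolding bspline_3_at_first_knot s_def[symmetric] by (simp add: algebra_simps)
qed

section \<open>All antiderivatives of a quadratic spline\<close>

text \<open>Both cubic splines integrate the same \<open>P\<close>, so their increments agree and
  comparing them at \<open>t 1\<close> suffices; partition of unity is not invoked.\<close>

lemma cubic_spline_add_const:
  assumes "integral_coeffs P c"
  shows "integral_coeffs P (\<lambda>i. c i + a)"
    and "x \<in> {t 1..t (int m + 2)} \<Longrightarrow> cubic_spline (\<lambda>i. c i + a) x = cubic_spline c x + a"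
proof -
  show shift: "integral_coeffs P (\<lambda>i. c i + a)"
    using assms by (simp add: integral_coeffs_def)
  assume "x \<in> {t 1..t (int m + 2)}"
  then have "cubic_spline (\<lambda>i. c i + a) x - cubic_spline (\<lambda>i. c i + a) (t 1) =
      cubic_spline c x - cubic_spline c (t 1)"
    using has_integral_unique quadratic_spline_has_integral assms shift by blast
  moreover have "cubic_spline (\<lambda>i. c i + a) (t 1) = cubic_spline c (t 1) + a"
    using cubic_spline_knot_integral_coeffs[OF assms, of 0]
      cubic_spline_knot_integral_coeffs[OF shift, of 0] by simp
  ultimately show "cubic_spline (\<lambda>i. c i + a) x = cubic_spline c x + a"
    by (simp add: algebra_simps)
qed

lemma antiderivative_iff_cubic_spline:
  assumes cont: "continuous_on {t 1..t (int m + 2)} (quadratic_spline P)"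
  shows "(\<forall>x\<in>{t 1..t (int m + 2)}.
      (r has_vector_derivative quadratic_spline P x) (at x within {t 1..t (int m + 2)}))
    \<longleftrightarrow> (\<exists>c. integral_coeffs P c \<and> (\<forall>x\<in>{t 1..t (int m + 2)}. r x = cubic_spline c x))"
    (is "?L \<longleftrightarrow> ?R")
proof
  assume r: ?L
  obtain c where c: "integral_coeffs P c" using integral_coeffs_ex by blast
  \<comment> \<open>Two antiderivatives differ by a constant, which the control points
    absorb.\<close>
  define a where "a = r (t 1) - cubic_spline c (t 1)"
  have "r x = cubic_spline (\<lambda>i. c i + a) x" if x: "x \<in> {t 1..t (int m + 2)}" for x
  proof -
    have "(quadratic_spline P has_integral r x - r (t 1)) {t 1..x}"
      using r x by (intro fundamental_theorem_of_calculus)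
        (auto intro: has_vector_derivative_within_subset[where S = "{t 1..t (int m + 2)}"])
    then have "r x - r (t 1) = cubic_spline c x - cubic_spline c (t 1)"
      using has_integral_unique quadratic_spline_has_integral[OF c x] by blast
    then show ?thesis
      unfolding cubic_spline_add_const(2)[OF c x] by (simp add: a_def algebra_simps)
  qed
  then show ?R using cubic_spline_add_const(1)[OF c] by blast
next
  assume ?R
  then obtain c where c: "integral_coeffs P c" and r: "\<And>x. x \<in> {t 1..t (int m + 2)} \<Longrightarrow> r x = cubic_spline c x"
    by blast
  show ?L
    using cubic_spline_has_vector_derivative[OF c _ cont] r
    by (blast intro: has_vector_derivative_transform)
qed

end

text \<open>That the curve is the stated spline is an equivalence over all \<open>r\<close>, and the
  arbitrary first control point an existence claim for every \<open>r0\<close>. As \<open>l\<close>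
  is complex, the length formula also says that its right side is real.\<close>

theorem mainTheorem11:
  fixes m :: nat
    and t :: "int \<Rightarrow> real"
    and d :: "nat \<Rightarrow> real"
    and z p \<sigma> l :: "nat \<Rightarrow> complex"
  assumes m: "m \<ge> 1"
    and t0: "t 0 = 0"
    and knots: "\<forall>k\<in>{-1..int m + 3}. t k < t (k + 1)"
    and d: "\<forall>k\<in>{1..m+3}. d k = t (int k) - t (int k - 1)"
    and p_ends: "p 0 = 0" "p (2*m+4) = 0"
    and p_odd: "\<forall>k\<le>m+1. p (2*k+1) = (z k)\<^sup>2"
    and p_even: "\<forall>k\<le>m. p (2*k+2) = z k * z (k+1)"
    and \<sigma>_ends: "\<sigma> 0 = 0" "\<sigma> (2*m+4) = 0"
    and \<sigma>_odd: "\<forall>k\<le>m+1. \<sigma> (2*k+1) = z k * cnj (z k)"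
    and \<sigma>_even: "\<forall>k\<le>m. \<sigma> (2*k+2) = 1/2 * (z k * cnj (z (k+1)) + z (k+1) * cnj (z k))"
    and l_start: "l 0 = 0" "l 1 = 0"
    and l_even: "\<forall>i\<le>m+1. l (2*i+2) = l (2*i+1)
                   + of_real ((d (i+1) + d (i+2)) / 3) * (z i * cnj (z i))"
    and l_odd: "\<forall>i\<le>m. l (2*i+3) = l (2*i+2)
                   + of_real (d (i+2) / 6) * (z i * cnj (z (i+1)) + z (i+1) * cnj (z i))"
    and l_end: "l (2*m+5) = l (2*m+4)"
  shows
    "(\<forall>x. (spline_curve 1 (mu_knots t) (m+1) z x)\<^sup>2
          = spline_curve 2 (nu_knots t) (2*m+4) p x)
   \<and> (\<forall>x. of_real ((cmod (spline_curve 1 (mu_knots t) (m+1) z x))\<^sup>2)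
          = spline_curve 2 (nu_knots t) (2*m+4) \<sigma> x)
   \<and> (d (m+2) = d 1 \<and> d (m+3) = d 2
      \<and> (\<forall>k\<in>{0,1}. (\<Sum>j=2-k..2*m+3-k.
             of_real (nu_knots t (j+3) - nu_knots t j) * p j) = 0)
      \<longrightarrow>
        (\<forall>r0. \<exists>c. c 0 = r0 \<and> ph_control_points m d z c)
      \<and> (\<forall>r :: real \<Rightarrow> complex.
           (\<forall>x\<in>{t 1..t (int m + 2)}.
              (r has_vector_derivative (spline_curve 1 (mu_knots t) (m+1) z x)\<^sup>2)
                (at x within {t 1..t (int m + 2)}))
           \<longleftrightarrow>
           (\<exists>c. ph_control_points m d z c \<and>
              (\<forall>x\<in>{t 1..t (int m + 2)}. r x = spline_curve 3 (rho_knots t) (2*m+5) c x)))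
      \<and> (\<forall>r :: real \<Rightarrow> complex.
           (\<forall>x\<in>{t 1..t (int m + 2)}.
              (r has_vector_derivative (spline_curve 1 (mu_knots t) (m+1) z x)\<^sup>2)
                (at x within {t 1..t (int m + 2)}))
           \<longrightarrow>
             r (t 1) = r (t (int m + 2))
           \<and> pythagorean_hodograph 2 (nu_knots t) (2*m+4) (t 1) (t (int m + 2)) r
           \<and> of_real (arc_length (t 1) (t (int m + 2)) r)
               = l (2*m+3) + (l (2*m+4) - l (2*m+3) - l 2)
                   * of_real (bspline 3 (rho_knots t) 2 (t 1))))"
proof -
  interpret spline_knots m t
    by unfold_locales (use knots in auto)
  have p: "(linear_spline z x)\<^sup>2 = quadratic_spline p x" for x
    using quadratic_spline_eq_product[of p z z x] p_ends p_odd p_even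
    by (simp add: power2_eq_square mult_ac)
  have cnj: "linear_spline (\<lambda>k. cnj (z k)) x = cnj (linear_spline z x)" for x
    by (simp add: spline_curve_def del: bspline.simps)
  have \<sigma>: "of_real ((cmod (linear_spline z x))\<^sup>2) = quadratic_spline \<sigma> x" for x
    using quadratic_spline_eq_product[of \<sigma> z "\<lambda>k. cnj (z k)" x] \<sigma>_ends \<sigma>_odd \<sigma>_even
    unfolding cnj complex_norm_square by simp
  have ph: "ph_control_points m d z c \<longleftrightarrow> integral_coeffs p c" for c
    unfolding integral_coeffs_iff[OF d p_ends] ph_control_points_def using p_odd p_even by simp
  \<comment> \<open>The \<open>1/6\<close> in \<open>l\<close> is the \<open>1/3\<close> of the
    recurrence times the \<open>1/2\<close> in \<open>\<sigma>\<close>.\<close>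
  have l: "integral_coeffs \<sigma> l"
    unfolding integral_coeffs_iff[OF d \<sigma>_ends]
    using l_start l_even l_odd l_end \<sigma>_odd \<sigma>_even by simp
  have cont: "continuous_on {t 1..t (int m + 2)} (quadratic_spline p)"
    unfolding p[symmetric, abs_def] by (intro continuous_intros continuous_on_linear_spline)
  note antiderivative = antiderivative_iff_cubic_spline[OF cont]
  have less: "t 1 < t (int m + 2)" by (rule knots_less) auto
  have closed: "r (t 1) = r (t (int m + 2))"
    and pythagorean: "pythagorean_hodograph 2 \<nu> (2*m+4) (t 1) (t (int m + 2)) r"
    and length: "of_real (arc_length (t 1) (t (int m + 2)) r)
        = l (2*m+3) + (l (2*m+4) - l (2*m+3) - l 2) * of_real (bspline 3 \<rho> 2 (t 1))"
    if d_per: "d (m+2) = d 1" "d (m+3) = d 2"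
      and sums: "\<forall>k\<in>{0,1}. (\<Sum>j=2-k..2*m+3-k. of_real (\<nu> (j+3) - \<nu> j) * p j) = 0"
      and r: "\<forall>x\<in>{t 1..t (int m + 2)}.
        (r has_vector_derivative quadratic_spline p x) (at x within {t 1..t (int m + 2)})"
    for r
  proof -
    have per: "t (int m + 2) - t (int m + 1) = t 1 - t 0" "t (int m + 3) - t (int m + 2) = t 2 - t 1"
      using d_per bspec[OF d, of "m + 2"] bspec[OF d, of "m + 3"] bspec[OF d, of 1] bspec[OF d, of 2]
      by (simp_all add: add_ac)
    obtain c where "integral_coeffs p c" and "\<forall>x\<in>{t 1..t (int m + 2)}. r x = cubic_spline c x"
      using r antiderivative by blast
    moreover from this have "cubic_spline c (t (int m + 2)) = cubic_spline c (t 1)"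
      using cubic_spline_closed[OF _ per] sums by blast
    ultimately show "r (t 1) = r (t (int m + 2))"
      using less by simp
    have norm: "(cmod (quadratic_spline p x)) = (cmod (linear_spline z x))\<^sup>2" for x
      unfolding p[symmetric] by (rule norm_power)
    \<comment> \<open>Witness for the Pythagorean property: the spline of \<open>\<sigma>\<close> is
      real-valued, so it equals the spline of the real parts.\<close>
    have "(\<Sum>i=0..2*m+4. Re (\<sigma> i) * bspline 2 \<nu> i x) = Re (quadratic_spline \<sigma> x)" for x
      by (simp add: spline_curve_def)
    then have "(\<Sum>i=0..2*m+4. Re (\<sigma> i) * bspline 2 \<nu> i x) = cmod (quadratic_spline p x)" for x
      unfolding norm \<sigma>[symmetric] by simp
    then show "pythagorean_hodograph 2 \<nu> (2*m+4) (t 1) (t (int m + 2)) r"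
      unfolding pythagorean_hodograph_def
    proof (intro exI[of _ "\<lambda>i. Re (\<sigma> i)"] ballI)
      fix x assume "x \<in> {t 1..t (int m + 2)}"
      then show "\<exists>v. (r has_vector_derivative v) (at x within {t 1..t (int m + 2)}) \<and>
          (Re v)\<^sup>2 + (Im v)\<^sup>2 = (\<Sum>i=0..2*m+4. Re (\<sigma> i) * bspline 2 \<nu> i x)\<^sup>2"
        using r unfolding \<open>\<And>x. _ = cmod (quadratic_spline p x)\<close> cmod_power2 by blast
    qed
    have "(quadratic_spline \<sigma> has_integral cubic_spline l (t (int m + 2)) - cubic_spline l (t 1))
        {t 1..t (int m + 2)}"
      using less by (intro quadratic_spline_has_integral[OF l]) simp
    moreover have "quadratic_spline \<sigma> x =
        of_real (norm (vector_derivative r (at x within {t 1..t (int m + 2)})))"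
      if "x \<in> {t 1..t (int m + 2)}" for x
    proof -
      \<comment> \<open>The interval is nondegenerate, so the derivative within it is
        unique.\<close>
      have "vector_derivative r (at x within {t 1..t (int m + 2)}) = quadratic_spline p x"
        using vector_derivative_within_cbox[of "t 1" "t (int m + 2)" x r] less r that by simp
      then show ?thesis
        unfolding \<sigma>[symmetric] norm[symmetric] by simp
    qed
    ultimately have "((\<lambda>x. complex_of_real (norm (vector_derivative r (at x within {t 1..t (int m + 2)}))))
        has_integral cubic_spline l (t (int m + 2)) - cubic_spline l (t 1)) {t 1..t (int m + 2)}"
      by (rule has_integral_eq[rotated])
    then have "of_real (arc_length (t 1) (t (int m + 2)) r) =
        cubic_spline l (t (int m + 2)) - cubic_spline l (t 1)"
      unfolding arc_length_def by (rule of_real_integral_eq)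
    then show "of_real (arc_length (t 1) (t (int m + 2)) r)
        = l (2*m+3) + (l (2*m+4) - l (2*m+3) - l 2) * of_real (bspline 3 \<rho> 2 (t 1))"
      using cubic_spline_increment_from_0[OF l l_start per] by simp
  qed
  show ?thesis
    unfolding p ph
  proof (intro conjI allI impI)
    \<comment> \<open>Rewriting with \<open>p\<close> has already replaced the square, so the first
      product formula is reflexivity here.\<close>
    show "quadratic_spline p x = quadratic_spline p x" for x ..
    show "of_real ((cmod (linear_spline z x))\<^sup>2) = quadratic_spline \<sigma> x" for x
      by (rule \<sigma>)
    show "\<exists>c. c 0 = r0 \<and> integral_coeffs p c" for r0
      by (rule integral_coeffs_ex)
  next
    fix r
    show "(\<forall>x\<in>{t 1..t (int m + 2)}.
        (r has_vector_derivative quadratic_spline p x) (at x within {t 1..t (int m + 2)}))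
      \<longleftrightarrow> (\<exists>c. integral_coeffs p c \<and> (\<forall>x\<in>{t 1..t (int m + 2)}. r x = cubic_spline c x))"
      by (rule antiderivative)
  next
    fix r
    assume per: "d (m+2) = d 1 \<and> d (m+3) = d 2
        \<and> (\<forall>k\<in>{0,1}. (\<Sum>j=2-k..2*m+3-k. of_real (\<nu> (j+3) - \<nu> j) * p j) = 0)"
      and r: "\<forall>x\<in>{t 1..t (int m + 2)}.
        (r has_vector_derivative quadratic_spline p x) (at x within {t 1..t (int m + 2)})"
    note facts = conjunct1[OF per] conjunct1[OF conjunct2[OF per]] conjunct2[OF conjunct2[OF per]] r
    show "r (t 1) = r (t (int m + 2))"
      by (rule closed[OF facts])
    show "pythagorean_hodograph 2 \<nu> (2*m+4) (t 1) (t (int m + 2)) r"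
      by (rule pythagorean[OF facts])
    show "of_real (arc_length (t 1) (t (int m + 2)) r)
        = l (2*m+3) + (l (2*m+4) - l (2*m+3) - l 2) * of_real (bspline 3 \<rho> 2 (t 1))"
      by (rule length[OF facts])
  qed
qed

end
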